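(* Let $(F,f_1,f_2,G,g_1,g_2)$ be a regular solution of $$F\Big(\frac{x+y}{2}\Big)+f_1(x)+f_2(y)=G(g_1(x)+g_2(y)),\qquad x,y\in I, \tag{E}$$ and put $\varphi:=\frac12F'$, $\psi_k:=\frac1{g_1'}+(-1)^k\frac1{g_2'}$ and $\Psi_k:=-\frac{f_1'}{g_1'}+(-1)^{k-1}\frac{f_2'}{g_2'}$ on $I$ for $k=1,2$. Suppose that either (A) $\varphi$ is constant on $I$, or (B.1) $\varphi$ is nowhere constant on $I$, $\psi_1=0$ on $I$, $\psi_2$ is constant on $I$, and there exist $A^*\in\varphi(I)$ and $\mu^*\in\mathbb{R}$ such that $\Psi_2=A^*\psi_2+\mu^*$ on $I$. Then either (1) $g_1$ and $g_2$ are arbitrary functions and there exist constants $A,B\in\mathbb{R}$ and $\lambda,\lambda_1,\lambda_2\in\mathbb{R}$ such that $$F(x)=Ax+\lambda,\qquad f_k(x)=-\tfrac12F(x)+Bg_k(x)+\lambda_k\ (k=1,2),\qquad G(u)=Bu+\Lambda,$$ or (2) $F$ is an arbitrary function and there exist $C,D\in\mathbb{R}$ with $D\neq0$ and $\lambda_1,\lambda_2,\mu_1,\mu_2\in\mathbb{R}$ such that $$f_k(x)=Cx+\lambda_k,\qquad g_k(x)=Dx+\mu_k\ (k=1,2),\qquad G(u)=F\Big(\frac{u-\mu}{2D}\Big)+C\,\frac{u-\mu}{D}+\Lambda$$ holds for all $x\in I$ and for all $u\in g_1(I)+g_2(I)$, where $\mu:=\mu_1+\mu_2$ and $\Lambda:=\lambda_1+\lambda_2$.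 Conversely, every $(F,f_1,f_2,G,g_1,g_2)$ with members defined as either in (1) or in (2) solves (E).
   Context: $I\subseteq\mathbb{R}$ is a nonempty open interval; $F,f_1,f_2,g_1,g_2:I\to\mathbb{R}$ and $G:g_1(I)+g_2(I)\to\mathbb{R}$, where $X+Y=\{x+y\mid x\in X,\ y\in Y\}$. The tuple $(F,f_1,f_2,G,g_1,g_2)$ is called regular if all six functions are continuously differentiable on their domains and $0\notin g_1'(I)\cup g_2'(I)$. A function on $I$ is locally constant if it is constant on some subinterval of $I$ of positive length different from $I$; it is nowhere constant on $I$ if it is neither constant on $I$ nor locally constant on $I$. "Arbitrary" in the conclusion means that no further restriction is imposed on the function in question. *)

theory Defs
  imports "HOL-Analysis.Analysis"
begin

text \<open>
  Functions on \<open>I\<close> (and \<open>G\<close> on the sumset \<open>g1 ` I + g2 ` I\<close>) are total functions on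
  the reals of which only the values on the domain matter. The sumset is the elementwise sum of
  \<open>HOL-Library.Set_Algebras\<close>.
\<close>

definition solves_E ::
  "real set \<Rightarrow> (real \<Rightarrow> real) \<Rightarrow> (real \<Rightarrow> real) \<Rightarrow> (real \<Rightarrow> real) \<Rightarrow> (real \<Rightarrow> real) \<Rightarrow>
   (real \<Rightarrow> real) \<Rightarrow> (real \<Rightarrow> real) \<Rightarrow> bool" where
  "solves_E I F f1 f2 G g1 g2 \<longleftrightarrow>
     (\<forall>x\<in>I. \<forall>y\<in>I. F ((x + y) / 2) + f1 x + f2 y = G (g1 x + g2 y))"

text \<open>
  \<open>C1_differentiable_on\<close> uses full-neighbourhood derivatives. This does not look outside the
  domains: \<open>I\<close> is open, and when \<open>g1\<close>, \<open>g2\<close> are \<open>C\<^sup>1\<close> with nonvanishing derivatives, the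
  sumset is open as well.
\<close>

definition regular ::
  "real set \<Rightarrow> (real \<Rightarrow> real) \<Rightarrow> (real \<Rightarrow> real) \<Rightarrow> (real \<Rightarrow> real) \<Rightarrow> (real \<Rightarrow> real) \<Rightarrow>
   (real \<Rightarrow> real) \<Rightarrow> (real \<Rightarrow> real) \<Rightarrow> bool" where
  "regular I F f1 f2 G g1 g2 \<longleftrightarrow>
     F C1_differentiable_on I \<and> f1 C1_differentiable_on I \<and> f2 C1_differentiable_on I \<and>
     G C1_differentiable_on (g1 ` I + g2 ` I) \<and>
     g1 C1_differentiable_on I \<and> g2 C1_differentiable_on I \<and>
     0 \<notin> deriv g1 ` I \<union> deriv g2 ` I"

text \<open>The subinterval \<open>J\<close> may be open, closed or half-open; \<open>a < b\<close> in \<open>J\<close> is positive length.\<close>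

definition locally_constant_on :: "(real \<Rightarrow> real) \<Rightarrow> real set \<Rightarrow> bool" where
  "locally_constant_on f I \<longleftrightarrow>
     (\<exists>J. is_interval J \<and> J \<subseteq> I \<and> J \<noteq> I \<and> (\<exists>a\<in>J. \<exists>b\<in>J. a < b) \<and> f constant_on J)"

definition nowhere_constant_on :: "(real \<Rightarrow> real) \<Rightarrow> real set \<Rightarrow> bool" where
  "nowhere_constant_on f I \<longleftrightarrow> \<not> f constant_on I \<and> \<not> locally_constant_on f I"

definition phi :: "(real \<Rightarrow> real) \<Rightarrow> real \<Rightarrow> real" where
  "phi F x = 1 / 2 * deriv F x"

definition psi :: "(real \<Rightarrow> real) \<Rightarrow> (real \<Rightarrow> real) \<Rightarrow> nat \<Rightarrow> real \<Rightarrow> real" where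
  "psi g1 g2 k x = 1 / deriv g1 x + (-1) ^ k * (1 / deriv g2 x)"

text \<open>Only used for \<open>k \<ge> 1\<close>, so the natural-number subtraction is exact.\<close>

definition Psi ::
  "(real \<Rightarrow> real) \<Rightarrow> (real \<Rightarrow> real) \<Rightarrow> (real \<Rightarrow> real) \<Rightarrow> (real \<Rightarrow> real) \<Rightarrow> nat \<Rightarrow> real \<Rightarrow> real" where
  "Psi f1 f2 g1 g2 k x =
     - (deriv f1 x / deriv g1 x) + (-1) ^ (k - 1) * (deriv f2 x / deriv g2 x)"

definition condition_A :: "real set \<Rightarrow> (real \<Rightarrow> real) \<Rightarrow> bool" where
  "condition_A I F \<longleftrightarrow> phi F constant_on I"

definition condition_B1 ::
  "real set \<Rightarrow> (real \<Rightarrow> real) \<Rightarrow> (real \<Rightarrow> real) \<Rightarrow> (real \<Rightarrow> real) \<Rightarrow>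
   (real \<Rightarrow> real) \<Rightarrow> (real \<Rightarrow> real) \<Rightarrow> bool" where
  "condition_B1 I F f1 f2 g1 g2 \<longleftrightarrow>
     nowhere_constant_on (phi F) I \<and>
     (\<forall>x\<in>I. psi g1 g2 1 x = 0) \<and>
     psi g1 g2 2 constant_on I \<and>
     (\<exists>A\<in>phi F ` I. \<exists>\<mu>. \<forall>x\<in>I. Psi f1 f2 g1 g2 2 x = A * psi g1 g2 2 x + \<mu>)"

definition form_1 ::
  "real set \<Rightarrow> (real \<Rightarrow> real) \<Rightarrow> (real \<Rightarrow> real) \<Rightarrow> (real \<Rightarrow> real) \<Rightarrow> (real \<Rightarrow> real) \<Rightarrow>
   (real \<Rightarrow> real) \<Rightarrow> (real \<Rightarrow> real) \<Rightarrow> bool" where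
  "form_1 I F f1 f2 G g1 g2 \<longleftrightarrow>
     (\<exists>A B l l1 l2.
        (\<forall>x\<in>I. F x = A * x + l \<and>
               f1 x = - (1 / 2) * F x + B * g1 x + l1 \<and>
               f2 x = - (1 / 2) * F x + B * g2 x + l2) \<and>
        (\<forall>u\<in>g1 ` I + g2 ` I. G u = B * u + (l1 + l2)))"

definition form_2 ::
  "real set \<Rightarrow> (real \<Rightarrow> real) \<Rightarrow> (real \<Rightarrow> real) \<Rightarrow> (real \<Rightarrow> real) \<Rightarrow> (real \<Rightarrow> real) \<Rightarrow>
   (real \<Rightarrow> real) \<Rightarrow> (real \<Rightarrow> real) \<Rightarrow> bool" where
  "form_2 I F f1 f2 G g1 g2 \<longleftrightarrow>
     (\<exists>C D l1 l2 \<mu>1 \<mu>2. D \<noteq> 0 \<and>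
        (\<forall>x\<in>I. f1 x = C * x + l1 \<and> f2 x = C * x + l2 \<and>
               g1 x = D * x + \<mu>1 \<and> g2 x = D * x + \<mu>2) \<and>
        (\<forall>u\<in>g1 ` I + g2 ` I.
           G u = F ((u - (\<mu>1 + \<mu>2)) / (2 * D)) + C * ((u - (\<mu>1 + \<mu>2)) / D) + (l1 + l2)))"

end

theory Submission
  imports Defs
begin

text \<open>
  Differentiating the equation with respect to \<open>x\<close> and to \<open>y\<close> gives
  \<open>\<phi>((x + y)/2) + f\<^sub>1'(x) = G'(g\<^sub>1(x) + g\<^sub>2(y)) g\<^sub>1'(x)\<close> and
  \<open>\<phi>((x + y)/2) + f\<^sub>2'(y) = G'(g\<^sub>1(x) + g\<^sub>2(y)) g\<^sub>2'(y)\<close>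
  (lemmas \<open>deriv_equation_fst\<close> and \<open>deriv_equation_snd\<close>). In both cases of the theorem,
  eliminating \<open>G'\<close> leaves an equation whose one side depends on \<open>x\<close> only and whose other side
  depends on \<open>y\<close> only, so both sides are constant.

  If \<open>\<phi>\<close> is a constant \<open>c\<close>, this equation is
  \<open>(c + f\<^sub>1'(x)) / g\<^sub>1'(x) = (c + f\<^sub>2'(y)) / g\<^sub>2'(y)\<close>. Calling the common value \<open>B\<close> and
  integrating yields \<open>f\<^sub>k = - F/2 + B g\<^sub>k + \<lambda>\<^sub>k\<close>.

  In the other case, \<open>\<psi>\<^sub>1 = 0\<close> and the constancy of \<open>\<psi>\<^sub>2\<close> force \<open>g\<^sub>1' = g\<^sub>2' = D\<close> with a
  constant \<open>D \<noteq> 0\<close>, so that \<open>f\<^sub>1'(x) = f\<^sub>2'(y)\<close>; hence \<open>f\<^sub>1' = f\<^sub>2' = C\<close> is constant and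
  all four functions are affine. The form of \<open>G\<close> is then read off from the equation.
\<close>

lemma C1_differentiable_on_imp_DERIV_deriv:
  fixes f :: "real \<Rightarrow> real"
  assumes "f C1_differentiable_on S" and "x \<in> S"
  shows "DERIV f x :> deriv f x"
proof -
  obtain f' where "(f has_vector_derivative f' x) (at x)"
    using assms unfolding C1_differentiable_on_def by blast
  then have "DERIV f x :> f' x"
    by (simp add: has_real_derivative_iff_has_vector_derivative)
  then show ?thesis
    by (simp add: DERIV_imp_deriv)
qed

lemma proportional_derivs_imp_affine_relation:
  fixes f g :: "real \<Rightarrow> real"
  assumes "convex I"
    and f: "\<And>x. x \<in> I \<Longrightarrow> DERIV f x :> f' x"
    and g: "\<And>x. x \<in> I \<Longrightarrow> DERIV g x :> g' x"
    and eq: "\<And>x. x \<in> I \<Longrightarrow> f' x = B * g' x"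
  obtains l where "\<And>x. x \<in> I \<Longrightarrow> f x = B * g x + l"
proof -
  have "((\<lambda>x. f x - B * g x) has_field_derivative 0) (at x within I)" if "x \<in> I" for x
  proof -
    have "DERIV (\<lambda>x. f x - B * g x) x :> f' x - B * g' x"
      by (intro DERIV_diff DERIV_cmult f g that)
    then show ?thesis
      using eq[OF that] by (simp add: has_field_derivative_at_within)
  qed
  then have "\<exists>l. \<forall>x\<in>I. f x - B * g x = l"
    by (intro has_field_derivative_zero_constant[OF \<open>convex I\<close>])
  then obtain l where "\<forall>x\<in>I. f x - B * g x = l" ..
  then show ?thesis
    using that[of l] by (simp add: algebra_simps)
qed

lemma midpoint_mem_interval:
  fixes x y :: real
  assumes "is_interval I" and "x \<in> I" and "y \<in> I"
  shows "(x + y) / 2 \<in> I"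
proof -
  have "convex I"
    using assms(1) by (rule is_interval_convex)
  from convexD[OF this assms(2,3), of "1/2" "1/2"] show ?thesis
    by (simp add: add_divide_distrib)
qed

lemma deriv_equation_fst:
  assumes "open I" and "is_interval I"
    and reg: "regular I F f1 f2 G g1 g2" and sol: "solves_E I F f1 f2 G g1 g2"
    and x: "x \<in> I" and y: "y \<in> I"
  shows "phi F ((x + y) / 2) + deriv f1 x = deriv G (g1 x + g2 y) * deriv g1 x"
proof -
  have F: "DERIV F ((x + y) / 2) :> deriv F ((x + y) / 2)"
    and f1: "DERIV f1 x :> deriv f1 x"
    and g1: "DERIV g1 x :> deriv g1 x"
    and G: "DERIV G (g1 x + g2 y) :> deriv G (g1 x + g2 y)"
    using reg x y midpoint_mem_interval[OF \<open>is_interval I\<close> x y]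
    unfolding regular_def by (auto intro!: C1_differentiable_on_imp_DERIV_deriv)
  have "DERIV (\<lambda>t. (t + y) / 2) x :> 1 / 2"
    by (auto intro!: derivative_eq_intros)
  from DERIV_chain2[where g = "\<lambda>t. (t + y) / 2", OF F this]
  have lhs: "DERIV (\<lambda>t. F ((t + y) / 2) + f1 t + f2 y) x :> phi F ((x + y) / 2) + deriv f1 x"
    using f1 by (auto intro!: derivative_eq_intros simp: phi_def)
  have "DERIV (\<lambda>t. g1 t + g2 y) x :> deriv g1 x"
    using g1 by (auto intro!: derivative_eq_intros)
  from DERIV_chain2[where g = "\<lambda>t. g1 t + g2 y", OF G this]
  have rhs: "DERIV (\<lambda>t. G (g1 t + g2 y)) x :> deriv G (g1 x + g2 y) * deriv g1 x" .
  have "DERIV (\<lambda>t. G (g1 t + g2 y)) x :> phi F ((x + y) / 2) + deriv f1 x"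
    by (rule has_field_derivative_transform_within_open[OF lhs \<open>open I\<close> x])
      (use sol y in \<open>simp add: solves_E_def\<close>)
  then show ?thesis
    using rhs by (rule DERIV_unique)
qed

lemma deriv_equation_snd:
  assumes "open I" and "is_interval I"
    and reg: "regular I F f1 f2 G g1 g2" and sol: "solves_E I F f1 f2 G g1 g2"
    and x: "x \<in> I" and y: "y \<in> I"
  shows "phi F ((x + y) / 2) + deriv f2 y = deriv G (g1 x + g2 y) * deriv g2 y"
proof -
  \<comment> \<open>The equation is invariant under exchanging the two variables together with the indices.\<close>
  have "regular I F f2 f1 G g2 g1"
    using reg unfolding regular_def by (auto simp: add.commute)
  moreover have "solves_E I F f2 f1 G g2 g1"
    unfolding solves_E_def
  proof (intro ballI)
    fix s t assume "s \<in> I" "t \<in> I"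
    then have "F ((t + s) / 2) + f1 t + f2 s = G (g1 t + g2 s)"
      using sol unfolding solves_E_def by blast
    then show "F ((s + t) / 2) + f2 s + f1 t = G (g2 s + g1 t)"
      by (simp add: ac_simps)
  qed
  ultimately show ?thesis
    using deriv_equation_fst[OF \<open>open I\<close> \<open>is_interval I\<close> _ _ y x, of F f2 f1 G g2 g1]
    by (simp add: add.commute)
qed

lemma condition_A_imp_form_1:
  assumes "I \<noteq> {}" and "open I" and "is_interval I"
    and reg: "regular I F f1 f2 G g1 g2" and sol: "solves_E I F f1 f2 G g1 g2"
    and A: "condition_A I F"
  shows "form_1 I F f1 f2 G g1 g2"
proof -
  have conv: "convex I"
    using \<open>is_interval I\<close> by (rule is_interval_convex)
  have D: "\<And>x. x \<in> I \<Longrightarrow> DERIV F x :> deriv F x"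
    "\<And>x. x \<in> I \<Longrightarrow> DERIV f1 x :> deriv f1 x" "\<And>x. x \<in> I \<Longrightarrow> DERIV f2 x :> deriv f2 x"
    "\<And>x. x \<in> I \<Longrightarrow> DERIV g1 x :> deriv g1 x" "\<And>x. x \<in> I \<Longrightarrow> DERIV g2 x :> deriv g2 x"
    using reg unfolding regular_def by (auto intro: C1_differentiable_on_imp_DERIV_deriv)
  have nz: "deriv g1 x \<noteq> 0" "deriv g2 x \<noteq> 0" if "x \<in> I" for x
    using reg that unfolding regular_def by (auto simp: image_iff)
  obtain c where c: "\<And>x. x \<in> I \<Longrightarrow> phi F x = c"
    using A unfolding condition_A_def constant_on_def by blast
  obtain x0 where x0: "x0 \<in> I"
    using \<open>I \<noteq> {}\<close> by blast
  obtain l where F: "\<And>x. x \<in> I \<Longrightarrow> F x = 2 * c * x + l"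
  proof (rule proportional_derivs_imp_affine_relation[OF conv D(1)])
    show "DERIV (\<lambda>x. x) x :> 1" for x :: real
      by simp
    show "deriv F x = 2 * c * 1" if "x \<in> I" for x
      using c[OF that] by (simp add: phi_def)
  qed blast+
  have sep: "(c + deriv f1 x) / deriv g1 x = (c + deriv f2 y) / deriv g2 y"
    if "x \<in> I" "y \<in> I" for x y
    using deriv_equation_fst[OF assms(2,3) reg sol that]
      deriv_equation_snd[OF assms(2,3) reg sol that] nz that
      c[OF midpoint_mem_interval[OF assms(3) that]]
    by simp
  define B where "B = (c + deriv f1 x0) / deriv g1 x0"
  have B2: "deriv f2 x + 1 / 2 * deriv F x = B * deriv g2 x" if "x \<in> I" for x
    using sep[OF x0 that] nz(2)[OF that] c[OF that] by (simp add: B_def phi_def field_simps)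
  have B1: "deriv f1 x + 1 / 2 * deriv F x = B * deriv g1 x" if "x \<in> I" for x
    using sep[OF that x0] sep[OF x0 x0] nz(1)[OF that] c[OF that]
    by (simp add: B_def phi_def field_simps)
  have E: "DERIV (\<lambda>t. f1 t + 1 / 2 * F t) x :> deriv f1 x + 1 / 2 * deriv F x"
    "DERIV (\<lambda>t. f2 t + 1 / 2 * F t) x :> deriv f2 x + 1 / 2 * deriv F x" if "x \<in> I" for x
    by (intro DERIV_add DERIV_cmult D that)+
  obtain l1 where l1: "\<And>x. x \<in> I \<Longrightarrow> f1 x + 1 / 2 * F x = B * g1 x + l1"
    using proportional_derivs_imp_affine_relation[OF conv E(1) D(4) B1] by blast
  obtain l2 where l2: "\<And>x. x \<in> I \<Longrightarrow> f2 x + 1 / 2 * F x = B * g2 x + l2"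
    using proportional_derivs_imp_affine_relation[OF conv E(2) D(5) B2] by blast
  have "G u = B * u + (l1 + l2)" if u: "u \<in> g1 ` I + g2 ` I" for u
  proof -
    obtain x y where xy: "x \<in> I" "y \<in> I" "u = g1 x + g2 y"
      using u by (auto elim!: set_plus_elim)
    have "F ((x + y) / 2) = 1 / 2 * F x + 1 / 2 * F y"
      using F xy midpoint_mem_interval[OF assms(3) xy(1,2)] by (simp add: field_simps)
    moreover have "G u = F ((x + y) / 2) + f1 x + f2 y"
      using sol xy unfolding solves_E_def by simp
    ultimately show ?thesis
      unfolding xy(3) distrib_left using l1[OF xy(1)] l2[OF xy(2)] by linarith
  qed
  moreover have "F x = 2 * c * x + l \<and> f1 x = - (1 / 2) * F x + B * g1 x + l1 \<and>
      f2 x = - (1 / 2) * F x + B * g2 x + l2" if "x \<in> I" for x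
    using F[OF that] l1[OF that] l2[OF that] by linarith
  ultimately show ?thesis
    unfolding form_1_def by blast
qed

text \<open>
  The assumptions on \<open>\<psi>\<^sub>1\<close> and \<open>\<psi>\<^sub>2\<close> say exactly that \<open>g\<^sub>1\<close> and \<open>g\<^sub>2\<close> are affine with the same
  slope, so the term with \<open>\<phi>\<close> cancels together with \<open>G'\<close> when the two derivative equations are
  subtracted.
\<close>

lemma psi_conditions_imp_form_2:
  assumes "I \<noteq> {}" and "open I" and "is_interval I"
    and reg: "regular I F f1 f2 G g1 g2" and sol: "solves_E I F f1 f2 G g1 g2"
    and psi1: "\<And>x. x \<in> I \<Longrightarrow> psi g1 g2 1 x = 0" and psi2: "psi g1 g2 2 constant_on I"
  shows "form_2 I F f1 f2 G g1 g2"
proof -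
  have conv: "convex I"
    using \<open>is_interval I\<close> by (rule is_interval_convex)
  have D: "\<And>x. x \<in> I \<Longrightarrow> DERIV f1 x :> deriv f1 x" "\<And>x. x \<in> I \<Longrightarrow> DERIV f2 x :> deriv f2 x"
    "\<And>x. x \<in> I \<Longrightarrow> DERIV g1 x :> deriv g1 x" "\<And>x. x \<in> I \<Longrightarrow> DERIV g2 x :> deriv g2 x"
    using reg unfolding regular_def by (auto intro: C1_differentiable_on_imp_DERIV_deriv)
  have nz: "deriv g1 x \<noteq> 0" "deriv g2 x \<noteq> 0" if "x \<in> I" for x
    using reg that unfolding regular_def by (auto simp: image_iff)
  obtain x0 where x0: "x0 \<in> I"
    using \<open>I \<noteq> {}\<close> by blast
  obtain p where p: "\<And>x. x \<in> I \<Longrightarrow> psi g1 g2 2 x = p"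
    using psi2 unfolding constant_on_def by blast
  have recip: "1 / deriv g1 x = p / 2" "1 / deriv g2 x = p / 2" if "x \<in> I" for x
    using psi1[OF that] p[OF that] by (simp_all add: psi_def)
  define d where "d = 2 / p"
  have "p \<noteq> 0"
    using recip(1)[OF x0] nz(1)[OF x0] by auto
  then have d: "deriv g1 x = d" "deriv g2 x = d" if "x \<in> I" for x
    using recip[OF that] nz[OF that] by (auto simp: d_def field_simps)
  have "d \<noteq> 0"
    using d(1)[OF x0] nz(1)[OF x0] by simp
  have sep: "deriv f1 x = deriv f2 y" if "x \<in> I" "y \<in> I" for x y
    using deriv_equation_fst[OF assms(2,3) reg sol that]
      deriv_equation_snd[OF assms(2,3) reg sol that] d that
    by simp
  define C where "C = deriv f1 x0"
  have C: "deriv f1 x = C" "deriv f2 x = C" if "x \<in> I" for x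
    using sep[OF that x0] sep[OF x0 x0] sep[OF x0 that] by (simp_all add: C_def)
  have aff: "\<exists>l. \<forall>x\<in>I. f x = a * x + l"
    if f: "\<And>x. x \<in> I \<Longrightarrow> DERIV f x :> deriv f x" and a: "\<And>x. x \<in> I \<Longrightarrow> deriv f x = a"
    for f :: "real \<Rightarrow> real" and a
  proof (rule proportional_derivs_imp_affine_relation[OF conv f])
    show "DERIV (\<lambda>x. x) x :> 1" for x :: real
      by simp
    show "deriv f x = a * 1" if "x \<in> I" for x
      using a[OF that] by simp
  qed blast+
  obtain l1 where l1: "\<forall>x\<in>I. f1 x = C * x + l1"
    using aff[OF D(1) C(1)] by blast
  obtain l2 where l2: "\<forall>x\<in>I. f2 x = C * x + l2"
    using aff[OF D(2) C(2)] by blast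
  obtain m1 where m1: "\<forall>x\<in>I. g1 x = d * x + m1"
    using aff[OF D(3) d(1)] by blast
  obtain m2 where m2: "\<forall>x\<in>I. g2 x = d * x + m2"
    using aff[OF D(4) d(2)] by blast
  note l = l1 l2 m1 m2
  have "G u = F ((u - (m1 + m2)) / (2 * d)) + C * ((u - (m1 + m2)) / d) + (l1 + l2)"
    if u: "u \<in> g1 ` I + g2 ` I" for u
  proof -
    obtain x y where xy: "x \<in> I" "y \<in> I" "u = g1 x + g2 y"
      using u by (auto elim!: set_plus_elim)
    have shift: "u - (m1 + m2) = d * (x + y)"
      using l xy by (simp add: algebra_simps)
    have "G u = F ((x + y) / 2) + f1 x + f2 y"
      using sol xy unfolding solves_E_def by simp
    also have "\<dots> = F ((x + y) / 2) + C * (x + y) + (l1 + l2)"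
      using l xy by (simp add: algebra_simps)
    finally show ?thesis
      unfolding shift using \<open>d \<noteq> 0\<close> by simp
  qed
  then show ?thesis
    unfolding form_2_def using l \<open>d \<noteq> 0\<close> by blast
qed

lemma form_1_imp_solves_E:
  assumes "is_interval I" and "form_1 I F f1 f2 G g1 g2"
  shows "solves_E I F f1 f2 G g1 g2"
  unfolding solves_E_def
proof (intro ballI)
  fix x y assume xy: "x \<in> I" "y \<in> I"
  obtain A B l l1 l2 where *:
    "\<And>x. x \<in> I \<Longrightarrow> F x = A * x + l \<and> f1 x = - (1 / 2) * F x + B * g1 x + l1 \<and>
       f2 x = - (1 / 2) * F x + B * g2 x + l2"
    "\<And>u. u \<in> g1 ` I + g2 ` I \<Longrightarrow> G u = B * u + (l1 + l2)"
    using assms(2) unfolding form_1_def by blast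
  have "G (g1 x + g2 y) = B * g1 x + B * g2 y + (l1 + l2)"
    using *(2)[of "g1 x + g2 y"] xy by (simp add: distrib_left set_plus_intro)
  moreover have "F ((x + y) / 2) = 1 / 2 * F x + 1 / 2 * F y"
    using *(1) xy midpoint_mem_interval[OF assms(1) xy] by (simp add: field_simps)
  ultimately show "F ((x + y) / 2) + f1 x + f2 y = G (g1 x + g2 y)"
    using *(1)[OF xy(1)] *(1)[OF xy(2)] by linarith
qed

lemma form_2_imp_solves_E:
  assumes "form_2 I F f1 f2 G g1 g2"
  shows "solves_E I F f1 f2 G g1 g2"
  unfolding solves_E_def
proof (intro ballI)
  fix x y assume xy: "x \<in> I" "y \<in> I"
  obtain C d l1 l2 m1 m2 where "d \<noteq> 0" and *:
    "\<And>x. x \<in> I \<Longrightarrow> f1 x = C * x + l1 \<and> f2 x = C * x + l2 \<and> g1 x = d * x + m1 \<and> g2 x = d * x + m2"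
    "\<And>u. u \<in> g1 ` I + g2 ` I \<Longrightarrow>
       G u = F ((u - (m1 + m2)) / (2 * d)) + C * ((u - (m1 + m2)) / d) + (l1 + l2)"
    using assms unfolding form_2_def by blast
  have u: "g1 x + g2 y - (m1 + m2) = d * (x + y)"
    using * xy by (simp add: algebra_simps)
  have "g1 x + g2 y \<in> g1 ` I + g2 ` I"
    using xy by blast
  from *(2)[OF this] have "G (g1 x + g2 y) = F ((x + y) / 2) + C * (x + y) + (l1 + l2)"
    unfolding u using \<open>d \<noteq> 0\<close> by simp
  then show "F ((x + y) / 2) + f1 x + f2 y = G (g1 x + g2 y)"
    using *(1)[OF xy(1)] *(1)[OF xy(2)] by (simp add: algebra_simps)
qed

theorem theorem13:
  fixes I :: "real set" and F f1 f2 G g1 g2 :: "real \<Rightarrow> real"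
  assumes "I \<noteq> {}" and "open I" and "is_interval I"
  shows "(regular I F f1 f2 G g1 g2 \<and> solves_E I F f1 f2 G g1 g2 \<and>
          (condition_A I F \<or> condition_B1 I F f1 f2 g1 g2)
            \<longrightarrow> form_1 I F f1 f2 G g1 g2 \<or> form_2 I F f1 f2 G g1 g2) \<and>
         (form_1 I F f1 f2 G g1 g2 \<or> form_2 I F f1 f2 G g1 g2
            \<longrightarrow> solves_E I F f1 f2 G g1 g2)"
proof (intro conjI impI; elim conjE disjE)
  assume "regular I F f1 f2 G g1 g2" "solves_E I F f1 f2 G g1 g2" "condition_A I F"
  then show "form_1 I F f1 f2 G g1 g2 \<or> form_2 I F f1 f2 G g1 g2"
    using condition_A_imp_form_1[OF assms] by blast
next
  assume reg: "regular I F f1 f2 G g1 g2" and sol: "solves_E I F f1 f2 G g1 g2"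
    and "condition_B1 I F f1 f2 g1 g2"
  then have "psi g1 g2 1 x = 0" if "x \<in> I" for x
    using that unfolding condition_B1_def by blast
  moreover have "psi g1 g2 2 constant_on I"
    using \<open>condition_B1 I F f1 f2 g1 g2\<close> unfolding condition_B1_def by blast
  ultimately show "form_1 I F f1 f2 G g1 g2 \<or> form_2 I F f1 f2 G g1 g2"
    using psi_conditions_imp_form_2[OF assms reg sol] by blast
next
  assume "form_1 I F f1 f2 G g1 g2"
  with \<open>is_interval I\<close> show "solves_E I F f1 f2 G g1 g2"
    by (rule form_1_imp_solves_E)
next
  assume "form_2 I F f1 f2 G g1 g2"
  then show "solves_E I F f1 f2 G g1 g2"
    by (rule form_2_imp_solves_E)
qed

end
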